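(* Let $g$ be a smooth function of $t$ on an open interval with $g$ and $g'$ nowhere zero. For a smooth function $w=w(t)$ put, for $y\ne0$, $$u=g'y^2\Big(w(t)-\frac{x}{gy^2}\Big).$$ Then $u$ is invariant under both $\mathbf v_0$ and $\mathbf x_g$, and $u$ solves the ZK equation $u_{xt}-(uu_x)_x-u_{yy}=0$ if and only if $-2wg'-\frac{g''}{g}=0$. This yields the group-invariant solution $$u=-y^2g'\Big(\frac{x}{y^2g}+\frac{g''}{2gg'}\Big).$$
   Context: $\mathbf v_0=2x\partial_x+y\partial_y+2u\partial_u$ and $\mathbf x_g=g\partial_x-g'\partial_u$ are vector fields on $(t,x,y,u)$-space; primes denote $d/dt$. A function $u(t,x,y)$ is invariant under a vector field if the field is tangent to its graph. *)

theory Defs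
  imports "HOL-Analysis.Analysis"
begin

text \<open>\<open>Ck_on k S f\<close> is meant for open \<open>S\<close>. As the domain is finite-dimensional, it says that all
  partial derivatives of \<open>f\<close> of order at most \<open>k\<close> exist and are continuous on \<open>S\<close>.\<close>

primrec Ck_on :: "nat \<Rightarrow> 'a set \<Rightarrow> ('a::euclidean_space \<Rightarrow> real) \<Rightarrow> bool" where
  "Ck_on 0 S f \<longleftrightarrow> continuous_on S f"
| "Ck_on (Suc k) S f \<longleftrightarrow>
     (\<forall>x\<in>S. f differentiable (at x)) \<and> (\<forall>v. Ck_on k S (\<lambda>x. frechet_derivative f (at x) v))"

definition smooth_on :: "'a set \<Rightarrow> ('a::euclidean_space \<Rightarrow> real) \<Rightarrow> bool" where
  "smooth_on S f \<longleftrightarrow> (\<forall>k. Ck_on k S f)"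

text \<open>Points \<open>(t, x, y)\<close> of the space of independent variables, and \<open>(t, x, y, u)\<close> of the space on
  which the vector fields live. A vector field is given by its components with respect to
  \<open>\<partial>\<^sub>t, \<partial>\<^sub>x, \<partial>\<^sub>y, \<partial>\<^sub>u\<close>.\<close>

type_synonym txy = "real \<times> real \<times> real"
type_synonym txyu = "real \<times> real \<times> real \<times> real"

definition v0 :: "txyu \<Rightarrow> txyu" where
  "v0 = (\<lambda>(t, x, y, u). (0, 2 * x, y, 2 * u))"

definition x_field :: "(real \<Rightarrow> real) \<Rightarrow> txyu \<Rightarrow> txyu" where
  "x_field g = (\<lambda>(t, x, y, u). (0, g t, 0, - deriv g t))"

definition graph_map :: "(txy \<Rightarrow> real) \<Rightarrow> txy \<Rightarrow> txyu" where
  "graph_map u = (\<lambda>(t, x, y). (t, x, y, u (t, x, y)))"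

text \<open>The tangent space of the graph of \<open>u\<close> at the point over \<open>q\<close> is the range of the derivative
  of \<open>graph_map u\<close> at \<open>q\<close>.\<close>

definition invariant_under :: "(txyu \<Rightarrow> txyu) \<Rightarrow> txy set \<Rightarrow> (txy \<Rightarrow> real) \<Rightarrow> bool" where
  "invariant_under X D u \<longleftrightarrow>
     (\<forall>q\<in>D. u differentiable (at q) \<and>
            X (graph_map u q) \<in> range (frechet_derivative (graph_map u) (at q)))"

definition D_t :: "(txy \<Rightarrow> real) \<Rightarrow> txy \<Rightarrow> real" where
  "D_t u = (\<lambda>(t, x, y). deriv (\<lambda>s. u (s, x, y)) t)"

definition D_x :: "(txy \<Rightarrow> real) \<Rightarrow> txy \<Rightarrow> real" where
  "D_x u = (\<lambda>(t, x, y). deriv (\<lambda>s. u (t, s, y)) x)"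

definition D_y :: "(txy \<Rightarrow> real) \<Rightarrow> txy \<Rightarrow> real" where
  "D_y u = (\<lambda>(t, x, y). deriv (\<lambda>s. u (t, x, s)) y)"

text \<open>Solutions are smooth, so every derivative in the equation exists.\<close>

definition solves_ZK :: "txy set \<Rightarrow> (txy \<Rightarrow> real) \<Rightarrow> bool" where
  "solves_ZK D u \<longleftrightarrow> smooth_on D u \<and>
     (\<forall>q\<in>D. D_t (D_x u) q - D_x (\<lambda>p. u p * D_x u p) q - D_y (D_y u) q = 0)"

definition domain_over :: "real set \<Rightarrow> txy set" where
  "domain_over I = {(t, x, y). t \<in> I \<and> y \<noteq> 0}"

definition ansatz :: "(real \<Rightarrow> real) \<Rightarrow> (real \<Rightarrow> real) \<Rightarrow> txy \<Rightarrow> real" where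
  "ansatz g w = (\<lambda>(t, x, y). deriv g t * y\<^sup>2 * (w t - x / (g t * y\<^sup>2)))"

definition invariant_solution :: "(real \<Rightarrow> real) \<Rightarrow> txy \<Rightarrow> real" where
  "invariant_solution g = (\<lambda>(t, x, y).
     - (y\<^sup>2) * deriv g t * (x / (y\<^sup>2 * g t) + deriv (deriv g) t / (2 * g t * deriv g t)))"

end

theory Submission
  imports Defs
begin

text \<open>Where \<open>y \<noteq> 0\<close>, both functions have the form \<open>u = a(t) y\<^sup>2 + b(t) x\<close> with \<open>b = - g' / g\<close>.
  Every such function is weighted homogeneous, hence invariant under \<open>v\<^sub>0\<close>; it is invariant
  under \<open>x\<^sub>g\<close> because \<open>g b = - g'\<close>; and the ZK equation reduces to \<open>b' - b\<^sup>2 - 2 a = 0\<close>.\<close>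

section \<open>Calculus of smooth functions\<close>

lemma has_derivative_frechet:
  "f differentiable (at x) \<Longrightarrow> (f has_derivative frechet_derivative f (at x)) (at x)"
  by (simp add: frechet_derivative_works)

text \<open>On an open set, functions that agree there also agree near each of its points and so
  share their Frechet derivatives; the induction then passes to directional derivatives. This lets a
  function be replaced by a formula valid only on \<open>S\<close>.\<close>

lemma Ck_on_cong:
  assumes "open S" "\<And>x. x \<in> S \<Longrightarrow> f x = h x" "Ck_on k S f"
  shows "Ck_on k S h"
  using assms(2,3)
proof (induction k arbitrary: f h)
  case 0
  then show ?case using continuous_on_cong[of S S f h] by simp
next
  case (Suc k)
  have D: "(h has_derivative frechet_derivative f (at x)) (at x)" if "x \<in> S" for x
    by (rule has_derivative_transform_within_open[OF has_derivative_frechet assms(1) that])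
       (use Suc.prems that in auto)
  have "Ck_on k S (\<lambda>x. frechet_derivative h (at x) v)" for v
    using Suc.IH[of "\<lambda>x. frechet_derivative f (at x) v"] Suc.prems(2)
    by (simp add: frechet_derivative_at[OF D, symmetric])
  then show ?case using D unfolding Ck_on.simps differentiable_def by blast
qed

text \<open>By uniqueness of derivatives, any explicit \<open>f'\<close> agrees with
  \<open>frechet_derivative\<close> on \<open>S\<close>. The closure properties below therefore need
  only a derivative formula whose values in each fixed direction are of class
  \<open>k\<close>.\<close>

lemma Ck_on_SucI:
  assumes "open S"
    and "\<And>x. x \<in> S \<Longrightarrow> (f has_derivative f' x) (at x)"
    and "\<And>v. Ck_on k S (\<lambda>x. f' x v)"
  shows "Ck_on (Suc k) S f"
proof -
  have "Ck_on k S (\<lambda>x. frechet_derivative f (at x) v)" for v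
    by (rule Ck_on_cong[OF assms(1) _ assms(3)[of v]])
       (simp add: frechet_derivative_at[OF assms(2), symmetric])
  then show ?thesis using assms(2) unfolding Ck_on.simps differentiable_def by blast
qed

lemma Ck_on_Suc_has_derivative:
  "Ck_on (Suc k) S f \<Longrightarrow> x \<in> S \<Longrightarrow> (f has_derivative frechet_derivative f (at x)) (at x)"
  by (simp add: has_derivative_frechet)

text \<open>Differentiability gives continuity at the bottom level; above it the claim passes to the
  directional derivatives. Product and reciprocal need this because undifferentiated factors occur
  in their derivatives.\<close>

lemma Ck_on_Suc_D: "Ck_on (Suc k) S f \<Longrightarrow> Ck_on k S f"
proof (induction k arbitrary: f)
  case 0
  then show ?case
    by (auto intro!: continuous_at_imp_continuous_on differentiable_imp_continuous_within)
next
  case (Suc k)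
  then show ?case unfolding Ck_on.simps(2)[of "Suc k"] Ck_on.simps(2)[of k S f] by blast
qed

lemma Ck_on_const: "open S \<Longrightarrow> Ck_on k S (\<lambda>x. c)"
  by (induction k arbitrary: c) (auto intro!: Ck_on_SucI derivative_eq_intros)

lemma Ck_on_bounded_linear:
  assumes "open S" "bounded_linear L"
  shows "Ck_on k S L"
proof (cases k)
  case 0
  then show ?thesis using assms by (simp add: linear_continuous_on)
next
  case (Suc j)
  show ?thesis unfolding Suc
    by (rule Ck_on_SucI[where f' = "\<lambda>_. L"])
       (use assms in \<open>auto intro: bounded_linear_imp_has_derivative Ck_on_const\<close>)
qed

lemma Ck_on_add:
  assumes "open S" "Ck_on k S f" "Ck_on k S h"
  shows "Ck_on k S (\<lambda>x. f x + h x)"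
  using assms(2,3)
proof (induction k arbitrary: f h)
  case 0
  then show ?case by (simp add: continuous_on_add)
next
  case (Suc k)
  show ?case
    by (rule Ck_on_SucI[where f' = "\<lambda>x v. frechet_derivative f (at x) v + frechet_derivative h (at x) v"])
       (use assms(1) Suc in \<open>auto intro!: has_derivative_add has_derivative_frechet\<close>)
qed

lemma Ck_on_mult:
  assumes "open S" "Ck_on k S f" "Ck_on k S h"
  shows "Ck_on k S (\<lambda>x. f x * h x)"
  using assms(2,3)
proof (induction k arbitrary: f h)
  case 0
  then show ?case by (simp add: continuous_on_mult)
next
  case (Suc k)
  have "Ck_on k S (\<lambda>x. f x * frechet_derivative h (at x) v + frechet_derivative f (at x) v * h x)" for v
    using Suc.prems Ck_on_Suc_D[OF Suc.prems(1)] Ck_on_Suc_D[OF Suc.prems(2)]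
    by (intro Ck_on_add Suc.IH assms(1)) auto
  moreover have "((\<lambda>x. f x * h x) has_derivative
      (\<lambda>v. f x * frechet_derivative h (at x) v + frechet_derivative f (at x) v * h x)) (at x)"
    if "x \<in> S" for x
    using Suc.prems that by (intro has_derivative_mult has_derivative_frechet) auto
  ultimately show ?case by (intro Ck_on_SucI[OF assms(1)])
qed

text \<open>The derivative of \<open>1/f\<close> is a product of \<open>1/f\<close> and a derivative
  of \<open>f\<close>, so the induction can keep \<open>f\<close> fixed: the lower class of
  \<open>1/f\<close> itself is all that is required.\<close>

lemma Ck_on_inverse:
  assumes "open S" "Ck_on k S f" "\<And>x. x \<in> S \<Longrightarrow> f x \<noteq> 0"
  shows "Ck_on k S (\<lambda>x. inverse (f x))"
  using assms(2)
proof (induction k)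
  case 0
  then show ?case using assms(3) by (simp add: continuous_on_inverse)
next
  case (Suc k)
  have inv: "Ck_on k S (\<lambda>x. inverse (f x))"
    using Suc.IH Ck_on_Suc_D[OF Suc.prems] by blast
  have "Ck_on k S (\<lambda>x. - 1 * (inverse (f x) * frechet_derivative f (at x) v * inverse (f x)))" for v
    using Suc.prems inv assms(1) by (intro Ck_on_mult Ck_on_const) auto
  moreover have "((\<lambda>x. inverse (f x)) has_derivative
      (\<lambda>v. - 1 * (inverse (f x) * frechet_derivative f (at x) v * inverse (f x)))) (at x)"
    if "x \<in> S" for x
    using Deriv.has_derivative_inverse[OF assms(3)[OF that] Ck_on_Suc_has_derivative[OF Suc.prems that]]
    by simp
  ultimately show ?case by (intro Ck_on_SucI[OF assms(1)])
qed

text \<open>For linear \<open>L\<close>, the derivative of \<open>f (L x)\<close> in direction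
  \<open>v\<close> is the derivative of \<open>f\<close> in the fixed direction \<open>L v\<close>,
  again composed with \<open>L\<close>, so the induction closes without products. It serves to view
  functions of \<open>t\<close> as functions of \<open>(t, x, y)\<close>.\<close>

lemma Ck_on_compose_linear:
  fixes L :: "'b::euclidean_space \<Rightarrow> 'a::euclidean_space"
  assumes "open T" "bounded_linear L" "\<And>x. x \<in> T \<Longrightarrow> L x \<in> S" "Ck_on k S f"
  shows "Ck_on k T (\<lambda>x. f (L x))"
  using assms(4)
proof (induction k arbitrary: f)
  case 0
  then show ?case
    using continuous_on_compose2[of S f T L] linear_continuous_on[OF assms(2)] assms(3) by auto
next
  case (Suc k)
  have "((\<lambda>x. f (L x)) has_derivative (\<lambda>v. frechet_derivative f (at (L x)) (L v))) (at x)"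
    if "x \<in> T" for x
    using has_derivative_compose[OF bounded_linear_imp_has_derivative[OF assms(2)]
        Ck_on_Suc_has_derivative[OF Suc.prems assms(3)[OF that]]] by simp
  moreover have "Ck_on k T (\<lambda>x. frechet_derivative f (at (L x)) (L v))" for v
    using Suc.prems by (intro Suc.IH) auto
  ultimately show ?case by (intro Ck_on_SucI[OF assms(1)])
qed

section \<open>Closure properties of smooth functions, and derivatives on the real line\<close>

lemma smooth_on_cong:
  "open S \<Longrightarrow> (\<And>x. x \<in> S \<Longrightarrow> f x = h x) \<Longrightarrow> smooth_on S f \<Longrightarrow> smooth_on S h"
  unfolding smooth_on_def using Ck_on_cong by blast

lemma smooth_on_const: "open S \<Longrightarrow> smooth_on S (\<lambda>x. c)"
  by (simp add: smooth_on_def Ck_on_const)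

lemma smooth_on_bounded_linear: "open S \<Longrightarrow> bounded_linear L \<Longrightarrow> smooth_on S L"
  by (simp add: smooth_on_def Ck_on_bounded_linear)

lemma smooth_on_add:
  "open S \<Longrightarrow> smooth_on S f \<Longrightarrow> smooth_on S h \<Longrightarrow> smooth_on S (\<lambda>x. f x + h x)"
  by (simp add: smooth_on_def Ck_on_add)

lemma smooth_on_mult:
  "open S \<Longrightarrow> smooth_on S f \<Longrightarrow> smooth_on S h \<Longrightarrow> smooth_on S (\<lambda>x. f x * h x)"
  by (simp add: smooth_on_def Ck_on_mult)

lemma smooth_on_minus:
  "open S \<Longrightarrow> smooth_on S f \<Longrightarrow> smooth_on S (\<lambda>x. - f x)"
  using smooth_on_mult[OF _ smooth_on_const[of S "- 1"]] by auto

lemma smooth_on_divide: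
  "open S \<Longrightarrow> smooth_on S f \<Longrightarrow> smooth_on S h \<Longrightarrow> (\<And>x. x \<in> S \<Longrightarrow> h x \<noteq> 0)
    \<Longrightarrow> smooth_on S (\<lambda>x. f x / h x)"
  by (simp add: smooth_on_def divide_inverse Ck_on_mult Ck_on_inverse)

lemma smooth_on_compose_linear:
  fixes L :: "'b::euclidean_space \<Rightarrow> 'a::euclidean_space"
  shows "open T \<Longrightarrow> bounded_linear L \<Longrightarrow> (\<And>x. x \<in> T \<Longrightarrow> L x \<in> S) \<Longrightarrow> smooth_on S f
    \<Longrightarrow> smooth_on T (\<lambda>x. f (L x))"
  unfolding smooth_on_def using Ck_on_compose_linear by blast

lemma smooth_on_has_field_derivative:
  fixes f :: "real \<Rightarrow> real"
  assumes "smooth_on S f" "t \<in> S"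
  shows "(f has_field_derivative deriv f t) (at t)"
proof -
  have "Ck_on (Suc 0) S f" using assms(1) by (simp only: smooth_on_def)
  then have "f differentiable (at t)" using assms(2) by simp
  then show ?thesis
    using DERIV_deriv_iff_real_differentiable by blast
qed

lemma smooth_on_deriv:
  fixes f :: "real \<Rightarrow> real"
  assumes "open S" "smooth_on S f"
  shows "smooth_on S (deriv f)"
proof -
  \<comment> \<open>On the real line, \<open>deriv f\<close> is the Frechet derivative in direction
    1.\<close>
  have "smooth_on S (\<lambda>x. frechet_derivative f (at x) 1)"
    using assms(2) unfolding smooth_on_def by (metis Ck_on.simps(2))
  then show ?thesis
    by (rule smooth_on_cong[OF assms(1), rotated])
       (use smooth_on_has_field_derivative[OF assms(2)] in
         \<open>metis frechet_derivative_at has_field_derivative_def mult.right_neutral\<close>)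
qed

section \<open>Functions of the form \<open>a(t) y\<^sup>2 + b(t) x\<close>\<close>

lemma mem_domain_over [simp]: "(t, x, y) \<in> domain_over I \<longleftrightarrow> t \<in> I \<and> y \<noteq> 0"
  by (simp add: domain_over_def)

lemma open_domain_over:
  assumes "open I"
  shows "open (domain_over I)"
proof -
  have "domain_over I = I \<times> UNIV \<times> (- {0})"
    by (auto simp: domain_over_def)
  moreover have "open (- {0 :: real})" by (simp add: open_Compl)
  ultimately show ?thesis using assms by (simp only: open_Times open_UNIV)
qed

text \<open>The derivative of the graph map is \<open>v\<close> to \<open>(v, u' v)\<close>, so
  tangency comes down to one scalar equation for the last component.\<close>

lemma mem_range_graph_map_derivative:
  assumes "(u has_derivative u') (at q)" "u' (a, b, c) = d"
  shows "(a, b, c, d) \<in> range (frechet_derivative (graph_map u) (at q))"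
proof -
  have "graph_map u = (\<lambda>q. (fst q, fst (snd q), snd (snd q), u q))"
    by (auto simp: graph_map_def)
  then have "(graph_map u has_derivative
      (\<lambda>v. (fst v, fst (snd v), snd (snd v), u' v))) (at q)"
    by (simp only:) (intro has_derivative_Pair has_derivative_fst has_derivative_snd
        has_derivative_ident assms(1))
  then have "frechet_derivative (graph_map u) (at q)
      = (\<lambda>v. (fst v, fst (snd v), snd (snd v), u' v))"
    by (rule frechet_derivative_at[symmetric])
  then have "frechet_derivative (graph_map u) (at q) (a, b, c) = (a, b, c, d)"
    using assms(2) by simp
  then show ?thesis by (rule range_eqI[OF sym])
qed

text \<open>The setting covers both the ansatz for each \<open>w\<close> and the closed-form
  solution. The formula is required only for \<open>y \<noteq> 0\<close>: at \<open>y = 0\<close>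
  division by zero makes the ansatz vanish, whereas \<open>b t * x\<close> need not.\<close>

locale quadratic_profile =
  fixes I :: "real set" and a b :: "real \<Rightarrow> real" and u :: "txy \<Rightarrow> real"
  assumes open_I: "open I"
    and smooth_a: "smooth_on I a"
    and smooth_b: "smooth_on I b"
    and profile: "\<And>t x y. t \<in> I \<Longrightarrow> y \<noteq> 0 \<Longrightarrow> u (t, x, y) = a t * y\<^sup>2 + b t * x"
begin

lemma has_derivative_u:
  assumes "t \<in> I" "y \<noteq> 0"
  shows "(u has_derivative
    (\<lambda>(p, q, r). deriv a t * p * y\<^sup>2 + a t * (2 * y * r) + deriv b t * p * x + b t * q)) (at (t, x, y))"
proof -
  have "((\<lambda>q::txy. a (fst q)) has_derivative (\<lambda>v. fst v * deriv a t)) (at (t, x, y))"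
       "((\<lambda>q::txy. b (fst q)) has_derivative (\<lambda>v. fst v * deriv b t)) (at (t, x, y))"
    using smooth_on_has_field_derivative[OF smooth_a assms(1)]
      smooth_on_has_field_derivative[OF smooth_b assms(1)]
    by (auto intro!: DERIV_compose_FDERIV[where g = fst and g' = fst] derivative_eq_intros)
  then have "((\<lambda>q. a (fst q) * (snd (snd q))\<^sup>2 + b (fst q) * fst (snd q)) has_derivative
    (\<lambda>(p, q, r). deriv a t * p * y\<^sup>2 + a t * (2 * y * r) + deriv b t * p * x + b t * q)) (at (t, x, y))"
    by (auto intro!: derivative_eq_intros simp: fun_eq_iff algebra_simps)
  \<comment> \<open>The derivative found so far is that of the explicit formula; it carries over to
    \<open>u\<close> because both agree on an open neighbourhood of the point.\<close>
  then show ?thesis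
    by (rule has_derivative_transform_within_open[OF _ open_domain_over[OF open_I]])
       (use assms profile in auto)
qed

text \<open>Both fields have no \<open>t\<close> component, and \<open>u_x = b\<close>,
  \<open>u_y = 2 a y\<close>. Tangency thus means that the \<open>u\<close> component is
  \<open>u_y \<eta> + u_x \<xi>\<close>.\<close>

lemma invariant_underI:
  assumes "\<And>t x y. t \<in> I \<Longrightarrow> y \<noteq> 0 \<Longrightarrow>
    \<exists>\<xi> \<eta>. X (t, x, y, u (t, x, y)) = (0, \<xi>, \<eta>, 2 * a t * y * \<eta> + b t * \<xi>)"
  shows "invariant_under X (domain_over I) u"
  unfolding invariant_under_def
proof
  fix q assume "q \<in> domain_over I"
  then obtain t x y where q: "q = (t, x, y)" "t \<in> I" "y \<noteq> 0"
    by (cases q) auto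
  note D = has_derivative_u[OF q(2,3), of x]
  obtain \<xi> \<eta> where "X (graph_map u q) = (0, \<xi>, \<eta>, 2 * a t * y * \<eta> + b t * \<xi>)"
    using assms[OF q(2,3), of x] unfolding graph_map_def q(1) by auto
  then show "u differentiable (at q) \<and>
      X (graph_map u q) \<in> range (frechet_derivative (graph_map u) (at q))"
    using D mem_range_graph_map_derivative[OF D, of 0 \<xi> \<eta> "2 * a t * y * \<eta> + b t * \<xi>"]
    by (simp add: q(1) differentiable_def) blast
qed

text \<open>This is the Euler identity \<open>2 x u_x + y u_y = 2 u\<close> for weights 2 in
  \<open>x\<close> and 1 in \<open>y\<close>.\<close>

lemma invariant_under_v0: "invariant_under v0 (domain_over I) u"
  by (rule invariant_underI) (auto simp: v0_def profile power2_eq_square algebra_simps)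

lemma invariant_under_x_field:
  assumes "\<And>t. t \<in> I \<Longrightarrow> b t * g t = - deriv g t"
  shows "invariant_under (x_field g) (domain_over I) u"
  by (rule invariant_underI) (auto simp: x_field_def assms)

lemma smooth_on_u: "smooth_on (domain_over I) u"
proof -
  note D = open_domain_over[OF open_I]
  have coeff: "smooth_on (domain_over I) (\<lambda>q. f (fst q))" if "smooth_on I f" for f
    using that by (intro smooth_on_compose_linear[OF D bounded_linear_fst]) (auto simp: domain_over_def)
  have x: "smooth_on (domain_over I) (\<lambda>q. fst (snd q))"
    by (intro smooth_on_bounded_linear[OF D] bounded_linear_fst_comp bounded_linear_snd)
  have y: "smooth_on (domain_over I) (\<lambda>q. snd (snd q))"
    by (intro smooth_on_bounded_linear[OF D] bounded_linear_snd_comp bounded_linear_snd)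
  have "smooth_on (domain_over I)
      (\<lambda>q. a (fst q) * (snd (snd q) * snd (snd q)) + b (fst q) * fst (snd q))"
    by (intro smooth_on_add smooth_on_mult coeff smooth_a smooth_b x y D)
  then show ?thesis
    by (rule smooth_on_cong[OF D, rotated]) (auto simp: profile power2_eq_square)
qed

section \<open>The terms of the ZK equation for a quadratic profile\<close>

lemma D_x_u:
  assumes "t \<in> I" "y \<noteq> 0"
  shows "D_x u (t, x, y) = b t"
  unfolding D_x_def using assms
  by (auto simp: profile intro!: DERIV_imp_deriv derivative_eq_intros)

lemma D_t_D_x_u:
  assumes "t \<in> I" "y \<noteq> 0"
  shows "D_t (D_x u) (t, x, y) = deriv b t"
proof -
  \<comment> \<open>The value of \<open>D_x u\<close> is known only over \<open>I\<close>; since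
    \<open>I\<close> is open, this covers all \<open>s\<close> near \<open>t\<close>, which
    determines the derivative.\<close>
  have "\<forall>\<^sub>F s in nhds t. D_x u (s, x, y) = b s"
    using eventually_nhds_in_open[OF open_I assms(1)] by eventually_elim (simp add: D_x_u assms(2))
  then show ?thesis unfolding D_t_def by (simp add: deriv_cong_ev)
qed

text \<open>Only \<open>x\<close> varies, so the point stays in the domain and the flux is the
  affine function \<open>(a y^2 + b x) b\<close> on the whole line.\<close>

lemma D_x_flux:
  assumes "t \<in> I" "y \<noteq> 0"
  shows "D_x (\<lambda>p. u p * D_x u p) (t, x, y) = (b t)\<^sup>2"
  unfolding D_x_def[of "\<lambda>p. u p * D_x u p"] using assms
  by (auto simp: profile D_x_u power2_eq_square intro!: DERIV_imp_deriv derivative_eq_intros)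

lemma D_y_D_y_u:
  assumes "t \<in> I" "y \<noteq> 0"
  shows "D_y (D_y u) (t, x, y) = 2 * a t"
proof -
  have nhd: "\<forall>\<^sub>F s in nhds r. s \<noteq> 0" if "r \<noteq> 0" for r :: real
    using eventually_nhds_in_open[of "- {0}" r] that by (simp add: open_Compl)
  \<comment> \<open>The first derivative is needed at every nonzero \<open>r\<close>, not just at
    \<open>y\<close>, because it is differentiated once more near \<open>y\<close>.\<close>
  have D1: "D_y u (t, x, r) = 2 * a t * r" if r: "r \<noteq> 0" for r
  proof -
    have "\<forall>\<^sub>F s in nhds r. u (t, x, s) = a t * s\<^sup>2 + b t * x"
      using nhd[OF r] by eventually_elim (simp add: profile assms(1))
    then have "D_y u (t, x, r) = deriv (\<lambda>s. a t * s\<^sup>2 + b t * x) r"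
      unfolding D_y_def by (simp add: deriv_cong_ev)
    also have "\<dots> = 2 * a t * r"
      by (auto intro!: DERIV_imp_deriv derivative_eq_intros)
    finally show ?thesis .
  qed
  have "\<forall>\<^sub>F s in nhds y. D_y u (t, x, s) = 2 * a t * s"
    using nhd[OF assms(2)] by eventually_elim (rule D1)
  then have "D_y (D_y u) (t, x, y) = deriv (\<lambda>s. 2 * a t * s) y"
    unfolding D_y_def[of "D_y u"] by (simp add: deriv_cong_ev)
  also have "\<dots> = 2 * a t"
    by (auto intro!: DERIV_imp_deriv derivative_eq_intros)
  finally show ?thesis .
qed

lemma solves_ZK_iff:
  "solves_ZK (domain_over I) u \<longleftrightarrow> (\<forall>t\<in>I. deriv b t - (b t)\<^sup>2 - 2 * a t = 0)"
proof -
  have "(\<forall>q\<in>domain_over I. P q) \<longleftrightarrow> (\<forall>t x y. t \<in> I \<and> y \<noteq> 0 \<longrightarrow> P (t, x, y))" for P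
    by (auto simp: domain_over_def)
  then have "solves_ZK (domain_over I) u \<longleftrightarrow>
      (\<forall>t (x::real) (y::real). t \<in> I \<and> y \<noteq> 0 \<longrightarrow> deriv b t - (b t)\<^sup>2 - 2 * a t = 0)"
    unfolding solves_ZK_def by (simp add: smooth_on_u D_t_D_x_u D_x_flux D_y_D_y_u)
  also have "\<dots> \<longleftrightarrow> (\<forall>t\<in>I. deriv b t - (b t)\<^sup>2 - 2 * a t = 0)"
    \<comment> \<open>The condition no longer involves \<open>x\<close> and \<open>y\<close>, and
      the value \<open>y = 1\<close> shows that the domain has points over every
      \<open>t\<close>.\<close>
    by (metis zero_neq_one)
  finally show ?thesis .
qed

end

section \<open>The ansatz and the closed-form solution as quadratic profiles\<close>

lemma deriv_neg_log_derivative: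
  fixes g :: "real \<Rightarrow> real"
  assumes "open I" "smooth_on I g" "t \<in> I" "g t \<noteq> 0"
  shows "deriv (\<lambda>s. - deriv g s / g s) t = - deriv (deriv g) t / g t + (deriv g t / g t)\<^sup>2"
  by (rule DERIV_imp_deriv)
     (use smooth_on_has_field_derivative[OF assms(2,3)]
        smooth_on_has_field_derivative[OF smooth_on_deriv[OF assms(1,2)] assms(3)] assms(4)
      in \<open>auto intro!: derivative_eq_intros simp: field_simps power2_eq_square\<close>)

theorem mainTheorem11:
  fixes I :: "real set" and g :: "real \<Rightarrow> real"
  assumes "open I" and "is_interval I"
    and "smooth_on I g"
    and "\<And>t. t \<in> I \<Longrightarrow> g t \<noteq> 0"
    and "\<And>t. t \<in> I \<Longrightarrow> deriv g t \<noteq> 0"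
  shows "(\<forall>w :: real \<Rightarrow> real. smooth_on I w \<longrightarrow>
            invariant_under v0 (domain_over I) (ansatz g w) \<and>
            invariant_under (x_field g) (domain_over I) (ansatz g w) \<and>
            (solves_ZK (domain_over I) (ansatz g w) \<longleftrightarrow>
               (\<forall>t\<in>I. - 2 * w t * deriv g t - deriv (deriv g) t / g t = 0)) \<and>
            ((\<forall>t\<in>I. - 2 * w t * deriv g t - deriv (deriv g) t / g t = 0) \<longrightarrow>
               (\<forall>q\<in>domain_over I. ansatz g w q = invariant_solution g q))) \<and>
         invariant_under v0 (domain_over I) (invariant_solution g) \<and>
         invariant_under (x_field g) (domain_over I) (invariant_solution g) \<and>
         solves_ZK (domain_over I) (invariant_solution g)"
proof -
  let ?D = "domain_over I"
  note g_nz = assms(4) and g'_nz = assms(5)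
  note smooth_g = \<open>smooth_on I g\<close>
  note smooth_g' = smooth_on_deriv[OF assms(1) smooth_g]
  note smooth_g'' = smooth_on_deriv[OF assms(1) smooth_g']
  \<comment> \<open>In the ansatz the factor \<open>y^2\<close> cancels in the \<open>x\<close>
    term, which leaves the coefficient \<open>- g' / g\<close>, independent of
    \<open>w\<close>.\<close>
  define b where "b = (\<lambda>t. - deriv g t / g t)"
  have smooth_b: "smooth_on I b"
    unfolding b_def using g_nz by (intro smooth_on_divide smooth_on_minus assms(1) smooth_g smooth_g')
  have b_g: "b t * g t = - deriv g t" if "t \<in> I" for t
    using g_nz[OF that] by (simp add: b_def)
  \<comment> \<open>The term \<open>(g' / g)^2\<close> in \<open>b'\<close> cancels against
    \<open>b^2\<close>. Here \<open>w\<close> is a number, so the identity applies both to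
    \<open>w t\<close> and to \<open>w\<^sub>0 t\<close>.\<close>
  have reduced: "deriv b t - (b t)\<^sup>2 - 2 * (deriv g t * w) = - 2 * w * deriv g t - deriv (deriv g) t / g t"
    if "t \<in> I" for t w
    unfolding b_def deriv_neg_log_derivative[OF assms(1) smooth_g that g_nz[OF that]]
    by (simp add: power_divide)

  have prof: "quadratic_profile I (\<lambda>t. deriv g t * w t) b (ansatz g w)" if "smooth_on I w" for w
    using that assms(1) smooth_b g_nz
    by unfold_locales (auto intro!: smooth_on_mult smooth_g' simp: ansatz_def b_def field_simps)

  \<comment> \<open>This is the root of \<open>- 2 w g' - g'' / g = 0\<close>, so that
    \<open>g' w\<^sub>0 = - g'' / (2 g)\<close> is the coefficient of \<open>y^2\<close> in the
    closed form.\<close>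
  define w\<^sub>0 where "w\<^sub>0 = (\<lambda>t. - deriv (deriv g) t / (2 * (g t * deriv g t)))"
  have smooth_w\<^sub>0: "smooth_on I w\<^sub>0"
    unfolding w\<^sub>0_def using g_nz g'_nz
    by (intro smooth_on_divide smooth_on_minus smooth_on_mult smooth_on_const assms(1)
        smooth_g smooth_g' smooth_g'') auto
  interpret sol: quadratic_profile I "\<lambda>t. deriv g t * w\<^sub>0 t" b "invariant_solution g"
  proof
    show "smooth_on I (\<lambda>t. deriv g t * w\<^sub>0 t)"
      by (intro smooth_on_mult assms(1) smooth_g' smooth_w\<^sub>0)
    show "invariant_solution g (t, x, y) = deriv g t * w\<^sub>0 t * y\<^sup>2 + b t * x"
      if "t \<in> I" "y \<noteq> 0" for t x y
      using that g_nz[of t] g'_nz[of t]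
      by (simp add: invariant_solution_def b_def w\<^sub>0_def field_simps)
  qed (fact assms(1) smooth_b)+

  \<comment> \<open>The equation is linear in \<open>w\<close> with leading coefficient
    \<open>- 2 g' \<noteq> 0\<close>. Uniqueness of the root identifies the ansatz with the closed
    form; that \<open>w\<^sub>0 t\<close> is a root makes the closed form solve the ZK
    equation.\<close>
  have w_eq: "- 2 * w * deriv g t - deriv (deriv g) t / g t = 0 \<longleftrightarrow> w = w\<^sub>0 t" if "t \<in> I" for t w
    using g_nz[OF that] g'_nz[OF that] by (auto simp: w\<^sub>0_def field_simps)

  have "invariant_under v0 ?D (ansatz g w) \<and> invariant_under (x_field g) ?D (ansatz g w) \<and>
      (solves_ZK ?D (ansatz g w) \<longleftrightarrow>
        (\<forall>t\<in>I. - 2 * w t * deriv g t - deriv (deriv g) t / g t = 0)) \<and>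
      ((\<forall>t\<in>I. - 2 * w t * deriv g t - deriv (deriv g) t / g t = 0) \<longrightarrow>
        (\<forall>q\<in>?D. ansatz g w q = invariant_solution g q))" if "smooth_on I w" for w
  proof -
    interpret quadratic_profile I "\<lambda>t. deriv g t * w t" b "ansatz g w"
      by (rule prof[OF that])
    have "solves_ZK ?D (ansatz g w) \<longleftrightarrow>
        (\<forall>t\<in>I. - 2 * w t * deriv g t - deriv (deriv g) t / g t = 0)"
      unfolding solves_ZK_iff by (intro ball_cong refl) (simp only: reduced)
    moreover have "\<forall>q\<in>?D. ansatz g w q = invariant_solution g q"
      if "\<forall>t\<in>I. - 2 * w t * deriv g t - deriv (deriv g) t / g t = 0"
      using that w_eq profile sol.profile by (auto simp: domain_over_def)
    ultimately show ?thesis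
      using invariant_under_v0 invariant_under_x_field[OF b_g] by blast
  qed
  moreover have "solves_ZK ?D (invariant_solution g)"
    unfolding sol.solves_ZK_iff by (intro ballI) (simp only: reduced w_eq)
  ultimately show ?thesis
    using sol.invariant_under_v0 sol.invariant_under_x_field[OF b_g] by blast
qed

end
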